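(* In the general Bayes factor setting described in the context, let $0\le\alpha\le1$ and let $S:\bigcup_{i=m+1}^\infty\langle\mathcal X^i\rangle\to\{0,1\}$ be the sequential test defined, for all $n>m$ and $x^n\in\langle\mathcal X^n\rangle$, by $S(x^n)=1$ if and only if $\beta_{n\mid m}\ge 1/\alpha$. Then for arbitrarily large (i.e. every) finite $T>m$ and ($\rho^{(m)}$-almost) every $x^m\in\langle\mathcal X^m\rangle$, $$\bar P_0\left(\exists n,\ m<n\le T:\ S(X^n)=1\mid x^m\right)=\bar P_0\left(\exists n,\ m<n\le T:\ \beta_{n\mid m}^{-1}\le\alpha\mid x^m\right)\le\alpha .$$
   Context: General setting. $(\Omega,\mathcal F)$ is a measurable space, $m\ge 0$ an integer, and $X_{m+1},X_{m+2},\dots$ are measurable functions on $\Omega$ with values in a measurable space $(\mathcal X,\Sigma)$. If $m>0$ there is in addition an initial sample $\langle X^{(m)}\rangle:\Omega\to\langle\mathcal X^m\rangle\subseteq\mathcal X^m$, where $\langle\mathcal X^m\rangle$ carries a $\sigma$-algebra. If $m=0$ there is no initial sample and conditioning on $x^m$ is vacuous. For $n\ge m$, $\langle\mathcal X^n\rangle=\{x^n\in\mathcal X^n:(x_1,\dots,x_m)\in\langle\mathcal X^m\rangle\}$ with the product $\sigma$-algebra, $X^n=(\langle X^{(m)}\rangle,X_{m+1},\dots,X_n)$, and $\mathcal F_n$ is the $\sigma$-algebra on $\Omega$ generated by $X^n$. For $x^n\in\langle\mathcal X^n\rangle$, $x^m$ denotes its initial segment. For a measure $Q$ on $(\Omega,\mathcal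 F)$, $Q^{(n)}$ is the distribution of $X^n$ under $Q$. Hypotheses. For $k\in\{0,1\}$, $H_k=\{P_{\theta\mid k}:\theta\in\Theta_k\}$ is a set of probability measures on $(\Omega,\mathcal F)$, $\Theta_k$ carries a suitable $\sigma$-algebra, and $\pi_k$ is a possibly improper (infinite) prior measure on $\Theta_k$. The Bayes marginal is $\bar P_k(A)=\int_{\Theta_k}P_{\theta\mid k}(A)\,\mathrm d\pi_k(\theta)$, a possibly infinite measure. Standing assumptions. For all $n\ge\max\{m,1\}$, all $k$ and $\theta\in\Theta_k$, the measures $P^{(n)}_{\theta\mid k},\bar P_0^{(n)},\bar P_1^{(n)}$ are mutually absolutely continuous, and $\bar P_0^{(n)},\bar P_1^{(n)}$ are $\sigma$-finite. $\rho$ is a measure on $(\Omega,\mathcal F)$ such that for these $n$, $\rho^{(n)}$ is mutually absolutely continuous with them (e.g. $\rho^{(n)}=\bar P_0^{(n)}$). For every $x^m\in\langle\mathcal X^m\rangle$ the posterior $$\pi_k(\Theta_k'\mid x^m)=\frac{\int_{\Theta_k'}\frac{\mathrm dP^{(m)}_{\theta\mid k}}{\mathrm d\rho^{(m)}}(x^m)\,\mathrm d\pi_k(\theta)}{\int_{\Theta_k}\frac{\mathrm dP^{(m)}_{\theta\mid k}}{\mathrm d\rho^{(m)}}(x^m)\,\mathrm d\pi_k(\theta)}$$ is a probability measure (for $m=0$ it is the prior $\pi_k$, which is then proper). Conditional marginals. $\bar P_k(A\mid x^m)=\int_{\Theta_k}P_{\theta\mid k}(A\mid\langle X^{(m)}\rangle=x^m)\,\mathrm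 d\pi_k(\theta\mid x^m)$, where $P_{\theta\mid k}(A\mid\langle X^{(m)}\rangle=x^m)$ is the value at $x^m$ of a version of the conditional probability given $\mathcal F_m$, thus defined up to a set of $\rho^{(m)}$-measure $0$. $\bar P_k(\cdot\mid x^m)$ is a probability measure on $(\Omega,\mathcal F)$. Conditional Bayes factor. For $n>m$, $\beta_{n\mid m}=\dfrac{\mathrm d\bar P_1^{(n)}(\cdot\mid x^m)}{\mathrm d\bar P_0^{(n)}(\cdot\mid x^m)}(x^n)$ (a function of $x^n$, evaluated at $x^n=X^n$ in probability statements), where $\bar P_k^{(n)}(\cdot\mid x^m)$ is the distribution of $X^n$ under $\bar P_k(\cdot\mid x^m)$. Convention: $1/0=\infty$. *)

theory Defs
  imports "HOL-Probability.Probability"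
begin

text \<open>
  A sample of length \<open>n\<close> is a function on \<open>{1..n}\<close>, undefined elsewhere.
  \<open>E\<close> is the observation space, \<open>W\<close> the space of admissible initial samples
  (a set of samples of length \<open>m\<close> with its own sigma-algebra), \<open>X0\<close> the initial sample and
  \<open>X i\<close>, for \<open>i > m\<close>, the later observations. Measures serving as measurable spaces
  (\<open>M\<close>, \<open>E\<close>, \<open>W\<close>) only contribute their carrier and sigma-algebra.
\<close>

text \<open>
  Samples of length \<open>n \<ge> m\<close> with an admissible initial segment; the sigma-algebra is the product of
  the one on initial samples and of \<open>n - m\<close> copies of the one on observations, pulled back along
  the splitting of a sample after place \<open>m\<close>.
\<close>

definition sample_space ::
    "'x measure \<Rightarrow> nat \<Rightarrow> (nat \<Rightarrow> 'x) measure \<Rightarrow> nat \<Rightarrow> (nat \<Rightarrow> 'x) measure" where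
  "sample_space E m W n =
     vimage_algebra {x \<in> {1..n} \<rightarrow>\<^sub>E space E. restrict x {1..m} \<in> space W}
       (\<lambda>x. (restrict x {1..m}, restrict x {m<..n})) (W \<Otimes>\<^sub>M Pi\<^sub>M {m<..n} (\<lambda>_. E))"

definition sample ::
    "nat \<Rightarrow> ('w \<Rightarrow> nat \<Rightarrow> 'x) \<Rightarrow> (nat \<Rightarrow> 'w \<Rightarrow> 'x) \<Rightarrow> nat \<Rightarrow> 'w \<Rightarrow> (nat \<Rightarrow> 'x)" where
  "sample m X0 X n \<omega> = (\<lambda>i\<in>{1..n}. if i \<le> m then X0 \<omega> i else X i \<omega>)"

definition law ::
    "'x measure \<Rightarrow> nat \<Rightarrow> (nat \<Rightarrow> 'x) measure \<Rightarrow> ('w \<Rightarrow> nat \<Rightarrow> 'x) \<Rightarrow> (nat \<Rightarrow> 'w \<Rightarrow> 'x)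
      \<Rightarrow> nat \<Rightarrow> 'w measure \<Rightarrow> (nat \<Rightarrow> 'x) measure" where
  "law E m W X0 X n Q = distr Q (sample_space E m W n) (sample m X0 X n)"

definition generated_algebra ::
    "'w measure \<Rightarrow> 'x measure \<Rightarrow> nat \<Rightarrow> (nat \<Rightarrow> 'x) measure \<Rightarrow> ('w \<Rightarrow> nat \<Rightarrow> 'x)
      \<Rightarrow> (nat \<Rightarrow> 'w \<Rightarrow> 'x) \<Rightarrow> nat \<Rightarrow> 'w measure" where
  "generated_algebra M E m W X0 X n =
     vimage_algebra (space M) (sample m X0 X n) (sample_space E m W n)"

definition mutually_absolutely_continuous :: "'a measure \<Rightarrow> 'a measure \<Rightarrow> bool" where
  "mutually_absolutely_continuous Q R \<longleftrightarrow> absolutely_continuous Q R \<and> absolutely_continuous R Q"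

text \<open>
  \<open>f\<close> is a version of the Radon-Nikodym derivative of \<open>R\<close> with respect to \<open>Q\<close>:
  the property by which \<^const>\<open>RN_deriv\<close> chooses one such function.
\<close>

definition RN_version :: "'a measure \<Rightarrow> 'a measure \<Rightarrow> ('a \<Rightarrow> ennreal) \<Rightarrow> bool" where
  "RN_version Q R f \<longleftrightarrow> f \<in> borel_measurable Q \<and> density Q f = R"

text \<open>
  The posterior on the parameters (carrier \<open>space \<pi>\<close>) for the likelihood \<open>lik \<theta> x\<close>.
  Without an initial sample it is the prior itself.
\<close>

definition posterior ::
    "nat \<Rightarrow> 't measure \<Rightarrow> ('t \<Rightarrow> (nat \<Rightarrow> 'x) \<Rightarrow> ennreal) \<Rightarrow> (nat \<Rightarrow> 'x) \<Rightarrow> 't measure" where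
  "posterior m \<pi> lik x =
     (if m = 0 then \<pi> else density \<pi> (\<lambda>\<theta>. lik \<theta> x / (\<integral>\<^sup>+\<theta>'. lik \<theta>' x \<partial>\<pi>)))"

text \<open>
  \<open>c A x\<close>, as a function of \<open>x\<close>, is a version of the conditional probability of \<open>A\<close> under \<open>Q\<close>
  given that the initial sample equals \<open>x\<close>.
\<close>

definition cond_prob_version ::
    "'w measure \<Rightarrow> 'x measure \<Rightarrow> nat \<Rightarrow> (nat \<Rightarrow> 'x) measure \<Rightarrow> ('w \<Rightarrow> nat \<Rightarrow> 'x)
      \<Rightarrow> (nat \<Rightarrow> 'w \<Rightarrow> 'x) \<Rightarrow> 'w measure \<Rightarrow> ('w set \<Rightarrow> (nat \<Rightarrow> 'x) \<Rightarrow> ennreal) \<Rightarrow> bool" where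
  "cond_prob_version M E m W X0 X Q c \<longleftrightarrow>
     (\<forall>A\<in>sets M. c A \<in> borel_measurable (sample_space E m W m) \<and>
        (AE \<omega> in Q. c A (sample m X0 X m \<omega>) =
           nn_cond_exp Q (generated_algebra M E m W X0 X m) (indicator A) \<omega>))"

text \<open>
  \<^const>\<open>measure_of\<close> yields the zero measure if the given set function is not countably additive,
  so \<open>prob_space (cond_marginal M m \<pi> lik c x)\<close> includes countable additivity.
\<close>

definition cond_marginal ::
    "'w measure \<Rightarrow> nat \<Rightarrow> 't measure \<Rightarrow> ('t \<Rightarrow> (nat \<Rightarrow> 'x) \<Rightarrow> ennreal)
      \<Rightarrow> ('t \<Rightarrow> 'w set \<Rightarrow> (nat \<Rightarrow> 'x) \<Rightarrow> ennreal) \<Rightarrow> (nat \<Rightarrow> 'x) \<Rightarrow> 'w measure" where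
  "cond_marginal M m \<pi> lik c x =
     measure_of (space M) (sets M) (\<lambda>A. \<integral>\<^sup>+\<theta>. c \<theta> A x \<partial>(posterior m \<pi> lik x))"

locale sampling =
  fixes M :: "'w measure" and E :: "'x measure" and m :: nat and W :: "(nat \<Rightarrow> 'x) measure"
    and X0 :: "'w \<Rightarrow> nat \<Rightarrow> 'x" and X :: "nat \<Rightarrow> 'w \<Rightarrow> 'x"
  assumes space_initial: "space W \<subseteq> {1..m} \<rightarrow>\<^sub>E space E"
    and initial_trivial: "m = 0 \<Longrightarrow> space W = {\<lambda>_. undefined}"
    and initial_measurable: "m > 0 \<Longrightarrow> X0 \<in> M \<rightarrow>\<^sub>M W"
    and observation_measurable: "\<And>i. i > m \<Longrightarrow> X i \<in> M \<rightarrow>\<^sub>M E"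

text \<open>
  The hypotheses \<open>k = 0, 1\<close> have the parameter spaces \<open>space (\<pi> k)\<close> and the Bayes marginals
  \<open>\<pi> k \<bind> P k\<close>; the monadic bind integrates \<open>P k\<close> over a prior of any total mass.
  \<open>lik k\<close> and \<open>cp k\<close> are arbitrary versions of the likelihoods and of the conditional probabilities.
  All measures required to be mutually absolutely continuous are compared with \<open>\<rho>\<close>.
\<close>

locale bayes_factor_setting = sampling M E m W X0 X
  for M :: "'w measure" and E :: "'x measure" and m :: nat and W :: "(nat \<Rightarrow> 'x) measure"
    and X0 :: "'w \<Rightarrow> nat \<Rightarrow> 'x" and X :: "nat \<Rightarrow> 'w \<Rightarrow> 'x" +
  fixes \<pi> :: "nat \<Rightarrow> 't measure" and P :: "nat \<Rightarrow> 't \<Rightarrow> 'w measure" and \<rho> :: "'w measure"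
    and lik :: "nat \<Rightarrow> 't \<Rightarrow> (nat \<Rightarrow> 'x) \<Rightarrow> ennreal"
    and cp :: "nat \<Rightarrow> 't \<Rightarrow> 'w set \<Rightarrow> (nat \<Rightarrow> 'x) \<Rightarrow> ennreal"
  assumes model: "\<And>k. k \<in> {0, 1} \<Longrightarrow> P k \<in> \<pi> k \<rightarrow>\<^sub>M prob_algebra M"
    and sets_reference: "sets \<rho> = sets M"
    and marginal_sigma_finite: "\<And>k n. k \<in> {0, 1} \<Longrightarrow> n \<ge> max m 1 \<Longrightarrow>
          sigma_finite_measure (law E m W X0 X n (\<pi> k \<bind> P k))"
    and marginal_equivalent: "\<And>k n. k \<in> {0, 1} \<Longrightarrow> n \<ge> max m 1 \<Longrightarrow>
          mutually_absolutely_continuous (law E m W X0 X n \<rho>) (law E m W X0 X n (\<pi> k \<bind> P k))"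
    and model_equivalent: "\<And>k n \<theta>. k \<in> {0, 1} \<Longrightarrow> n \<ge> max m 1 \<Longrightarrow> \<theta> \<in> space (\<pi> k) \<Longrightarrow>
          mutually_absolutely_continuous (law E m W X0 X n \<rho>) (law E m W X0 X n (P k \<theta>))"
    and likelihood: "\<And>k \<theta>. k \<in> {0, 1} \<Longrightarrow> m > 0 \<Longrightarrow> \<theta> \<in> space (\<pi> k) \<Longrightarrow>
          RN_version (law E m W X0 X m \<rho>) (law E m W X0 X m (P k \<theta>)) (lik k \<theta>)"
    and likelihood_measurable: "\<And>k x. k \<in> {0, 1} \<Longrightarrow> m > 0 \<Longrightarrow> x \<in> space (sample_space E m W m) \<Longrightarrow>
          (\<lambda>\<theta>. lik k \<theta> x) \<in> borel_measurable (\<pi> k)"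
    and posterior_prob: "\<And>k x. k \<in> {0, 1} \<Longrightarrow> x \<in> space (sample_space E m W m) \<Longrightarrow>
          prob_space (posterior m (\<pi> k) (lik k) x)"
    and cond_prob: "\<And>k \<theta>. k \<in> {0, 1} \<Longrightarrow> \<theta> \<in> space (\<pi> k) \<Longrightarrow>
          cond_prob_version M E m W X0 X (P k \<theta>) (cp k \<theta>)"
    and cond_prob_measurable: "\<And>k. k \<in> {0, 1} \<Longrightarrow>
          AE x in law E m W X0 X m \<rho>. \<forall>A\<in>sets M. (\<lambda>\<theta>. cp k \<theta> A x) \<in> borel_measurable (\<pi> k)"
    and cond_marginal_prob: "\<And>k. k \<in> {0, 1} \<Longrightarrow>
          AE x in law E m W X0 X m \<rho>. prob_space (cond_marginal M m (\<pi> k) (lik k) (cp k) x)"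

text \<open>
  \<open>\<beta> n\<close> is a function of the sample of length \<open>n\<close> alone, which contains the initial segment
  conditioned on; for almost every \<open>x\<close> it is a version of the Radon-Nikodym derivative of the
  laws of that sample under the two marginals conditional on \<open>x\<close>.
\<close>

definition cond_bayes_factor ::
    "'w measure \<Rightarrow> 'x measure \<Rightarrow> nat \<Rightarrow> (nat \<Rightarrow> 'x) measure \<Rightarrow> ('w \<Rightarrow> nat \<Rightarrow> 'x)
      \<Rightarrow> (nat \<Rightarrow> 'w \<Rightarrow> 'x) \<Rightarrow> (nat \<Rightarrow> 't measure) \<Rightarrow> 'w measure
      \<Rightarrow> (nat \<Rightarrow> 't \<Rightarrow> (nat \<Rightarrow> 'x) \<Rightarrow> ennreal)
      \<Rightarrow> (nat \<Rightarrow> 't \<Rightarrow> 'w set \<Rightarrow> (nat \<Rightarrow> 'x) \<Rightarrow> ennreal)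
      \<Rightarrow> (nat \<Rightarrow> (nat \<Rightarrow> 'x) \<Rightarrow> ennreal) \<Rightarrow> bool" where
  "cond_bayes_factor M E m W X0 X \<pi> \<rho> lik cp \<beta> \<longleftrightarrow>
     (\<forall>n>m. AE x in law E m W X0 X m \<rho>.
        RN_version
          (law E m W X0 X n (cond_marginal M m (\<pi> 0) (lik 0) (cp 0) x))
          (law E m W X0 X n (cond_marginal M m (\<pi> 1) (lik 1) (cp 1) x)) (\<beta> n))"

end

theory Submission
  imports Defs
begin

text \<open>
  Fix an initial segment \<open>x\<close> outside a null set and write \<open>Q0\<close>, \<open>Q1\<close> for the two marginals
  conditional on \<open>x\<close>. The bound is Ville's inequality for the likelihood ratio of \<open>Q1\<close> to \<open>Q0\<close>,
  and the reason is a change of measure at the first time the ratio reaches the threshold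
  \<open>1 / \<alpha>\<close>. Whether that time equals \<open>n\<close> is determined by the sample of length \<open>n\<close>, whose laws
  under \<open>Q0\<close> and \<open>Q1\<close> are related by the density \<open>\<beta> n\<close>. On this event the density is at least
  \<open>1 / \<alpha>\<close>, so its \<open>Q1\<close>-probability is at least \<open>1 / \<alpha>\<close> times its \<open>Q0\<close>-probability. The
  events for different \<open>n\<close> are disjoint; summing over \<open>n\<close> gives
  \<open>1 / \<alpha> * Q0 (rejection by time T) \<le> Q1 (rejection by time T) \<le> 1\<close>.

  The argument is \<open>threshold_times_crossing_le\<close>, for two measures observed through a nested family
  of statistics. The sampling model supplies the nestedness: a shorter sample is a measurable
  function of a longer one (\<open>measurable_restrict_sample\<close>, \<open>restrict_sample\<close>). Since only the finitely
  many \<open>n \<le> T\<close> occur, one null set of initial segments serves for all the densities \<open>\<beta> n\<close>.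

  Keeping the threshold as a factor on the left, rather than dividing by it, lets \<open>\<alpha> = 0\<close> go
  through with the threshold \<open>\<infinity>\<close>.
\<close>

text \<open>
  Nestedness (\<open>nested\<close>) expresses through the maps \<open>r\<close> that the statistics \<open>Y n\<close> generate an
  increasing family of sigma-algebras; without it the absence of an earlier crossing need not be an
  event about \<open>Y n\<close>, and the density \<open>\<beta> n\<close> would say nothing about its probability.
\<close>

lemma threshold_times_crossing_le:
  fixes \<beta> :: "nat \<Rightarrow> 'y \<Rightarrow> ennreal" and c :: ennreal
  assumes sets_Q: "sets Q1 = sets Q0"
    and fin: "finite I"
    and Y: "\<And>n. n \<in> I \<Longrightarrow> Y n \<in> Q0 \<rightarrow>\<^sub>M N n"
    and r: "\<And>n j. n \<in> I \<Longrightarrow> j \<in> I \<Longrightarrow> j < n \<Longrightarrow> r n j \<in> N n \<rightarrow>\<^sub>M N j"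
    and nested: "\<And>n j \<omega>. n \<in> I \<Longrightarrow> j \<in> I \<Longrightarrow> j < n \<Longrightarrow> \<omega> \<in> space Q0 \<Longrightarrow> r n j (Y n \<omega>) = Y j \<omega>"
    and ratio: "\<And>n. n \<in> I \<Longrightarrow> RN_version (distr Q0 (N n) (Y n)) (distr Q1 (N n) (Y n)) (\<beta> n)"
  shows "c * emeasure Q0 {\<omega> \<in> space Q0. \<exists>n\<in>I. c \<le> \<beta> n (Y n \<omega>)}
           \<le> emeasure Q1 {\<omega> \<in> space Q0. \<exists>n\<in>I. c \<le> \<beta> n (Y n \<omega>)}"
proof -
  have space_Q: "space Q1 = space Q0"
    using sets_Q by (rule sets_eq_imp_space_eq)
  have Y1: "Y n \<in> Q1 \<rightarrow>\<^sub>M N n" if "n \<in> I" for n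
    using Y[OF that] by (simp add: measurable_cong_sets[OF sets_Q refl])
  have \<beta>: "\<beta> n \<in> borel_measurable (N n)" if "n \<in> I" for n
    using ratio[OF that] by (simp add: RN_version_def)
  \<comment> \<open>The first crossing at \<open>n\<close>, as a set of values of \<open>Y n\<close>; \<open>A n\<close> is the corresponding event.\<close>
  define B where "B n = {y \<in> space (N n). c \<le> \<beta> n y \<and> (\<forall>j\<in>I \<inter> {..<n}. \<beta> j (r n j y) < c)}" for n
  define A where "A n = Y n -` B n \<inter> space Q0" for n
  have B: "B n \<in> sets (N n)" if n: "n \<in> I" for n
  proof -
    have "{y \<in> space (N n). \<beta> j (r n j y) < c} \<in> sets (N n)" if "j \<in> I \<inter> {..<n}" for j
    proof -
      have "(\<lambda>y. \<beta> j (r n j y)) \<in> borel_measurable (N n)"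
        using measurable_compose[OF r \<beta>] n that by auto
      then show ?thesis by measurable
    qed
    then have "{y \<in> space (N n). \<forall>j\<in>I \<inter> {..<n}. \<beta> j (r n j y) < c} \<in> sets (N n)"
      using fin by (intro sets.sets_Collect_finite_All) auto
    moreover have "{y \<in> space (N n). c \<le> \<beta> n y} \<in> sets (N n)"
      using \<beta>[OF n] by measurable
    ultimately show ?thesis
      unfolding B_def by (rule sets.sets_Collect_conj)
  qed
  have A: "A n \<in> sets Q0" if "n \<in> I" for n
    unfolding A_def by (rule measurable_sets[OF Y[OF that] B[OF that]])
  have A_iff: "\<omega> \<in> A n \<longleftrightarrow>
      \<omega> \<in> space Q0 \<and> c \<le> \<beta> n (Y n \<omega>) \<and> (\<forall>j\<in>I \<inter> {..<n}. \<beta> j (Y j \<omega>) < c)" if "n \<in> I" for n \<omega>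
    using measurable_space[OF Y[OF that]] nested[OF that] by (auto simp: A_def B_def)
  have later: "\<omega> \<notin> A k" if "n \<in> I" "k \<in> I" "n < k" "\<omega> \<in> A n" for n k \<omega>
    using that by (auto simp: A_iff not_less intro!: bexI[of _ n])
  have disj: "disjoint_family_on A I"
    unfolding disjoint_family_on_def
  proof (intro ballI impI)
    fix n k assume "n \<in> I" "k \<in> I" "n \<noteq> k"
    then show "A n \<inter> A k = {}"
      using later[of n k] later[of k n] by (cases n k rule: linorder_cases) blast+
  qed
  have union: "(\<Union>n\<in>I. A n) = {\<omega> \<in> space Q0. \<exists>n\<in>I. c \<le> \<beta> n (Y n \<omega>)}" (is "_ = ?C")
  proof (intro equalityI subsetI)
    fix \<omega> assume \<omega>: "\<omega> \<in> ?C"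
    let ?crossed = "\<lambda>n. n \<in> I \<and> c \<le> \<beta> n (Y n \<omega>)"
    define n where "n = Least ?crossed"
    have "\<exists>n. ?crossed n"
      using \<omega> by blast
    then have "?crossed n"
      unfolding n_def by (rule LeastI_ex)
    moreover have "\<beta> j (Y j \<omega>) < c" if "j \<in> I \<inter> {..<n}" for j
      using that not_less_Least[of j ?crossed] unfolding n_def[symmetric] by (auto simp: not_le)
    ultimately show "\<omega> \<in> (\<Union>n\<in>I. A n)"
      using \<omega> by (auto simp: A_iff)
  qed (auto simp: A_iff)
  have step: "c * emeasure Q0 (A n) \<le> emeasure Q1 (A n)" if n: "n \<in> I" for n
  proof -
    let ?L = "distr Q0 (N n) (Y n)"
    have "c * emeasure Q0 (A n) = (\<integral>\<^sup>+y. c * indicator (B n) y \<partial>?L)"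
      using B[OF n] by (simp add: A_def emeasure_distr[OF Y[OF n]] nn_integral_cmult_indicator)
    also have "\<dots> \<le> (\<integral>\<^sup>+y. \<beta> n y * indicator (B n) y \<partial>?L)"
      by (intro nn_integral_mono) (auto simp: B_def split: split_indicator)
    also have "\<dots> = emeasure (density ?L (\<beta> n)) (B n)"
      using B[OF n] \<beta>[OF n] by (simp add: emeasure_density)
    also have "\<dots> = emeasure Q1 (A n)"
      using ratio[OF n] B[OF n]
      by (simp add: RN_version_def A_def emeasure_distr[OF Y1[OF n]] space_Q)
    finally show ?thesis .
  qed
  have total: "emeasure Q ?C = (\<Sum>n\<in>I. emeasure Q (A n))" if "sets Q = sets Q0" for Q
    unfolding union[symmetric] using A that by (intro sum_emeasure[symmetric] disj fin) auto
  have "c * emeasure Q0 ?C = (\<Sum>n\<in>I. c * emeasure Q0 (A n))"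
    by (simp only: total sum_distrib_left)
  also have "\<dots> \<le> (\<Sum>n\<in>I. emeasure Q1 (A n))"
    by (intro sum_mono step)
  also have "\<dots> = emeasure Q1 ?C"
    using sets_Q by (rule total[symmetric])
  finally show ?thesis .
qed

text \<open>
  The sigma-algebra on samples comes from splitting a sample after place \<open>m\<close>, so measurability is
  read off the two parts: for \<open>j \<ge> m\<close> the cut keeps the initial part whole and only discards
  coordinates of the product.
\<close>

lemma measurable_restrict_sample:
  assumes "m \<le> j" "j \<le> n"
  shows "(\<lambda>x. restrict x {1..j}) \<in> sample_space E m W n \<rightarrow>\<^sub>M sample_space E m W j"
proof -
  let ?D = "{x \<in> {1..n} \<rightarrow>\<^sub>E space E. restrict x {1..m} \<in> space W}"
  let ?split = "\<lambda>x. (restrict x {1..m}, restrict x {m<..n})"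
  let ?P = "\<lambda>n. W \<Otimes>\<^sub>M Pi\<^sub>M {m<..n} (\<lambda>_. E)"
  have space_n: "space (sample_space E m W n) = ?D"
    by (simp add: sample_space_def)
  have "?split \<in> ?D \<rightarrow> space (?P n)"
    by (auto simp: space_pair_measure space_PiM)
  then have split: "?split \<in> sample_space E m W n \<rightarrow>\<^sub>M ?P n"
    unfolding sample_space_def by (rule measurable_vimage_algebra1)
  have "(\<lambda>p. (fst p, restrict (snd p) {m<..j})) \<in> ?P n \<rightarrow>\<^sub>M ?P j"
    using assms
    by (intro measurable_Pair measurable_fst measurable_compose[OF measurable_snd]
        measurable_restrict_subset) auto
  from measurable_compose[OF split this] have
    "(\<lambda>x. (restrict x {1..m}, restrict (restrict x {m<..n}) {m<..j})) \<in> sample_space E m W n \<rightarrow>\<^sub>M ?P j"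
    by (simp only: fst_conv snd_conv)
  moreover have "restrict (restrict x {1..j}) {1..m} = restrict x {1..m}"
      "restrict (restrict x {1..j}) {m<..j} = restrict (restrict x {m<..n}) {m<..j}" for x :: "nat \<Rightarrow> 'a"
    using assms by (auto simp: restrict_def)
  ultimately show ?thesis
    using assms unfolding sample_space_def[of E m W j]
    by (intro measurable_vimage_algebra2) (auto simp: space_n)
qed

lemma restrict_sample:
  assumes "j \<le> n"
  shows "restrict (sample m X0 X n \<omega>) {1..j} = sample m X0 X j \<omega>"
  using assms by (auto simp: sample_def restrict_def)

context sampling
begin

lemma measurable_sample:
  assumes "m \<le> n"
  shows "sample m X0 X n \<in> M \<rightarrow>\<^sub>M sample_space E m W n"
proof -
  have initial: "(\<lambda>\<omega>. restrict (sample m X0 X n \<omega>) {1..m}) \<in> M \<rightarrow>\<^sub>M W"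
  proof (cases "m = 0")
    case True
    \<comment> \<open>The restriction to no places is the constant \<open>\<lambda>_. undefined\<close>, the only point of \<open>W\<close>.\<close>
    then show ?thesis
      using initial_trivial by (simp add: restrict_def)
  next
    case False
    have "restrict (sample m X0 X n \<omega>) {1..m} = X0 \<omega>" if "\<omega> \<in> space M" for \<omega>
    proof -
      have "X0 \<omega> \<in> {1..m} \<rightarrow>\<^sub>E space E"
        using measurable_space[OF initial_measurable that] space_initial False by auto
      then show ?thesis
        using assms by (auto simp: sample_def fun_eq_iff PiE_def extensional_def)
    qed
    then show ?thesis
      using initial_measurable False by (subst measurable_cong) auto
  qed
  have later: "(\<lambda>\<omega>. restrict (sample m X0 X n \<omega>) {m<..n}) \<in> M \<rightarrow>\<^sub>M Pi\<^sub>M {m<..n} (\<lambda>_. E)"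
  proof (rule measurable_cong[THEN iffD2])
    show "(\<lambda>\<omega>. \<lambda>i\<in>{m<..n}. X i \<omega>) \<in> M \<rightarrow>\<^sub>M Pi\<^sub>M {m<..n} (\<lambda>_. E)"
      using observation_measurable by (intro measurable_restrict) auto
  qed (auto simp: sample_def restrict_def)
  have "sample m X0 X n \<omega> i \<in> space E" if "\<omega> \<in> space M" "i \<in> {1..n}" for \<omega> i
  proof (cases "i \<le> m")
    case True
    have "restrict (sample m X0 X n \<omega>) {1..m} \<in> {1..m} \<rightarrow>\<^sub>E space E"
      by (rule subsetD[OF space_initial measurable_space[OF initial that(1)]])
    then have "restrict (sample m X0 X n \<omega>) {1..m} i \<in> space E"
      by (rule PiE_mem) (use True that(2) in simp)
    then show ?thesis
      using True that(2) by simp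
  next
    case False
    then show ?thesis
      using that measurable_space[OF observation_measurable] by (simp add: sample_def)
  qed
  moreover have "sample m X0 X n \<omega> \<in> extensional {1..n}" for \<omega>
    by (simp add: sample_def)
  ultimately have "sample m X0 X n \<in>
      space M \<rightarrow> {x \<in> {1..n} \<rightarrow>\<^sub>E space E. restrict x {1..m} \<in> space W}"
    using measurable_space[OF initial] by (auto simp: PiE_def)
  then show ?thesis
    unfolding sample_space_def
    by (rule measurable_vimage_algebra2) (rule measurable_Pair[OF initial later])
qed

text \<open>
  A probability is at most \<open>1\<close>, so \<open>threshold_times_crossing_le\<close> with the threshold \<open>1 / \<alpha>\<close> gives
  the bound upon multiplying by \<open>\<alpha>\<close>. If \<open>\<alpha> = 0\<close>, an infinite multiple of the probability is at most
  \<open>1\<close>, which forces the probability to vanish.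
\<close>

lemma rejection_prob_le:
  fixes \<alpha> :: real
  assumes Q0: "prob_space Q0" "sets Q0 = sets M" and Q1: "prob_space Q1" "sets Q1 = sets M"
    and ratio: "\<And>n. m < n \<Longrightarrow> n \<le> T \<Longrightarrow>
      RN_version (law E m W X0 X n Q0) (law E m W X0 X n Q1) (\<beta> n)"
    and \<alpha>: "0 \<le> \<alpha>"
  shows "measure Q0 {\<omega> \<in> space M. \<exists>n. m < n \<and> n \<le> T \<and> 1 / ennreal \<alpha> \<le> \<beta> n (sample m X0 X n \<omega>)} \<le> \<alpha>"
proof -
  interpret Q0: prob_space Q0 by (rule Q0(1))
  interpret Q1: prob_space Q1 by (rule Q1(1))
  have space_Q0: "space Q0 = space M"
    using Q0(2) by (rule sets_eq_imp_space_eq)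
  let ?C = "{\<omega> \<in> space M. \<exists>n. m < n \<and> n \<le> T \<and> 1 / ennreal \<alpha> \<le> \<beta> n (sample m X0 X n \<omega>)}"
  have C: "?C = {\<omega> \<in> space Q0. \<exists>n\<in>{m<..T}. 1 / ennreal \<alpha> \<le> \<beta> n (sample m X0 X n \<omega>)}"
    by (auto simp: space_Q0)
  have "1 / ennreal \<alpha> * emeasure Q0 ?C \<le> emeasure Q1 ?C"
    unfolding C
  proof (rule threshold_times_crossing_le[where N = "sample_space E m W" and r = "\<lambda>n j x. restrict x {1..j}"])
    show "sample m X0 X n \<in> Q0 \<rightarrow>\<^sub>M sample_space E m W n" if "n \<in> {m<..T}" for n
      using measurable_sample[of n] that by (simp add: measurable_cong_sets[OF Q0(2) refl])
    show "(\<lambda>x. restrict x {1..j}) \<in> sample_space E m W n \<rightarrow>\<^sub>M sample_space E m W j"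
      if "n \<in> {m<..T}" "j \<in> {m<..T}" "j < n" for n j
      using that by (intro measurable_restrict_sample) auto
    show "restrict (sample m X0 X n \<omega>) {1..j} = sample m X0 X j \<omega>" if "j < n" for n j \<omega>
      using that by (intro restrict_sample) simp
  qed (use ratio in \<open>auto simp: Q0 Q1 law_def\<close>)
  also have "\<dots> \<le> 1"
    by (rule Q1.emeasure_le_1)
  finally have *: "1 / ennreal \<alpha> * ennreal (measure Q0 ?C) \<le> 1"
    by (simp add: Q0.emeasure_eq_measure)
  show ?thesis
  proof (cases "\<alpha> = 0")
    case True
    then have "measure Q0 ?C = 0"
      using * by (simp add: divide_ennreal_def ennreal_top_mult top_unique split: if_splits)
    then show ?thesis
      by (simp add: True)
  next
    case False
    have "1 / ennreal \<alpha> = ennreal (1 / \<alpha>)"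
      using False \<alpha> divide_ennreal[of 1 \<alpha>] by simp
    then have "ennreal (1 / \<alpha>) * ennreal (measure Q0 ?C) \<le> ennreal 1"
      using * by (simp only: ennreal_1)
    then have "1 / \<alpha> * measure Q0 ?C \<le> 1"
      using \<alpha> by (subst (asm) ennreal_mult[symmetric]) (simp_all only: ennreal_le_iff zero_le_one measure_nonneg zero_le_divide_1_iff)
    then show ?thesis
      using False \<alpha> by (simp add: field_simps)
  qed
qed

end

lemma sets_cond_marginal: "sets (cond_marginal M m \<pi> lik c x) = sets M"
  by (simp add: cond_marginal_def)

lemma inverse_le_iff_le_ennreal: "inverse b \<le> a \<longleftrightarrow> 1 / a \<le> b" for a b :: ennreal
proof (cases "a \<in> {0, \<infinity>} \<or> b \<in> {0, \<infinity>}")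
  case True
  then show ?thesis
    by (auto simp: divide_ennreal_def top_unique)
next
  case False
  then obtain r s where "a = ennreal r" "b = ennreal s" "0 < r" "0 < s"
    by (cases a; cases b) (auto simp: less_le)
  then show ?thesis
    by (simp add: divide_ennreal_def inverse_ennreal field_simps)
qed

theorem corollary5:
  fixes M :: "'w measure" and E :: "'x measure" and m :: nat and W :: "(nat \<Rightarrow> 'x) measure"
    and X0 :: "'w \<Rightarrow> nat \<Rightarrow> 'x" and X :: "nat \<Rightarrow> 'w \<Rightarrow> 'x"
    and \<pi> :: "nat \<Rightarrow> 't measure" and P :: "nat \<Rightarrow> 't \<Rightarrow> 'w measure" and \<rho> :: "'w measure"
    and lik :: "nat \<Rightarrow> 't \<Rightarrow> (nat \<Rightarrow> 'x) \<Rightarrow> ennreal"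
    and cp :: "nat \<Rightarrow> 't \<Rightarrow> 'w set \<Rightarrow> (nat \<Rightarrow> 'x) \<Rightarrow> ennreal"
    and \<beta> :: "nat \<Rightarrow> (nat \<Rightarrow> 'x) \<Rightarrow> ennreal"
    and S :: "nat \<Rightarrow> (nat \<Rightarrow> 'x) \<Rightarrow> nat"
    and \<alpha> :: real and T :: nat
  assumes setting: "bayes_factor_setting M E m W X0 X \<pi> P \<rho> lik cp"
    and bayes_factor: "cond_bayes_factor M E m W X0 X \<pi> \<rho> lik cp \<beta>"
    and alpha: "0 \<le> \<alpha>" "\<alpha> \<le> 1"
    and test_range: "\<And>n x. n > m \<Longrightarrow> x \<in> space (sample_space E m W n) \<Longrightarrow> S n x \<in> {0, 1}"
    and test: "\<And>n x. n > m \<Longrightarrow> x \<in> space (sample_space E m W n) \<Longrightarrow>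
                 S n x = 1 \<longleftrightarrow> \<beta> n x \<ge> 1 / ennreal \<alpha>"
    and horizon: "T > m"
  shows "AE x in law E m W X0 X m \<rho>.
      measure (cond_marginal M m (\<pi> 0) (lik 0) (cp 0) x)
          {\<omega> \<in> space M. \<exists>n. m < n \<and> n \<le> T \<and> S n (sample m X0 X n \<omega>) = 1}
        = measure (cond_marginal M m (\<pi> 0) (lik 0) (cp 0) x)
          {\<omega> \<in> space M. \<exists>n. m < n \<and> n \<le> T \<and> inverse (\<beta> n (sample m X0 X n \<omega>)) \<le> ennreal \<alpha>}
    \<and> measure (cond_marginal M m (\<pi> 0) (lik 0) (cp 0) x)
          {\<omega> \<in> space M. \<exists>n. m < n \<and> n \<le> T \<and> inverse (\<beta> n (sample m X0 X n \<omega>)) \<le> ennreal \<alpha>}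
        \<le> \<alpha>"
proof -
  interpret bayes_factor_setting M E m W X0 X \<pi> P \<rho> lik cp
    by (rule setting)
  let ?Q = "\<lambda>k x. cond_marginal M m (\<pi> k) (lik k) (cp k) x"
  have "AE x in law E m W X0 X m \<rho>. \<forall>n\<in>{m<..T}.
      RN_version (law E m W X0 X n (?Q 0 x)) (law E m W X0 X n (?Q 1 x)) (\<beta> n)"
    using bayes_factor by (intro AE_finite_allI) (auto simp: cond_bayes_factor_def)
  moreover have "AE x in law E m W X0 X m \<rho>. prob_space (?Q 0 x)"
    by (rule cond_marginal_prob) simp
  moreover have "AE x in law E m W X0 X m \<rho>. prob_space (?Q 1 x)"
    by (rule cond_marginal_prob) simp
  ultimately show ?thesis
  proof eventually_elim
    case (elim x)
    let ?R = "{\<omega> \<in> space M. \<exists>n. m < n \<and> n \<le> T \<and> inverse (\<beta> n (sample m X0 X n \<omega>)) \<le> ennreal \<alpha>}"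
    have "measure (?Q 0 x) ?R \<le> \<alpha>"
      unfolding inverse_le_iff_le_ennreal
      by (rule rejection_prob_le[where ?Q1.0 = "?Q 1 x"]) (use elim alpha in \<open>auto simp: sets_cond_marginal\<close>)
    moreover have "{\<omega> \<in> space M. \<exists>n. m < n \<and> n \<le> T \<and> S n (sample m X0 X n \<omega>) = 1} = ?R"
      using test measurable_space[OF measurable_sample]
      by (intro Collect_cong conj_cong ex_cong1 refl) (simp add: inverse_le_iff_le_ennreal less_imp_le)
    ultimately show ?case
      by simp
  qed
qed

end
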